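(* Let $a<b$, let $0<\alpha,\beta\le 1$ with $\alpha+\beta>1$, and let $\psi\in C^1[a,b]$ with $\psi'(t)>0$ for all $t\in[a,b]$. Let $G$ be the Green function defined in the context. Then for all $t_1,t_2$ with $a\le t_1\le t_2\le b$ and all $\tau\in[a,b]$, $$|G(\tau,t_2)-G(\tau,t_1)|\le\frac{2}{\Gamma(\alpha+\beta)}(\psi(t_2)-\psi(t_1))^{\alpha+\beta-1}.$$
   Context: The Green function $G:[a,b]\times[a,b]\to\mathbb{R}$ is $$G(\tau,t)=\begin{cases} C(\psi(t)-\psi(a))^\beta(\psi(b)-\psi(\tau))^{\alpha+\beta-1}-D(\psi(t)-\psi(\tau))^{\alpha+\beta-1}, & a\le\tau\le t\le b,\\ C(\psi(t)-\psi(a))^\beta(\psi(b)-\psi(\tau))^{\alpha+\beta-1}, & a\le t\le\tau\le b,\end{cases}$$ with $C=\dfrac{1}{\Gamma(\alpha+\beta)(\psi(b)-\psi(a))^{\beta}}$ and $D=\dfrac{1}{\Gamma(\alpha+\beta)}$, where $\Gamma$ is the Gamma function. *)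

theory Defs
  imports "HOL-Analysis.Analysis"
begin

text \<open>
  On \<open>a \<le> \<tau>, t \<le> b\<close> and increasing \<open>\<psi>\<close>, every base of a \<open>powr\<close> below is nonnegative and every
  exponent is positive, so the Isabelle convention \<open>0 powr x = 0\<close> agrees with the usual meaning.
  The two clauses of the paper overlap on \<open>\<tau> = t\<close>, where they give the same value.
\<close>

definition Green ::
    "real \<Rightarrow> real \<Rightarrow> real \<Rightarrow> real \<Rightarrow> (real \<Rightarrow> real) \<Rightarrow> real \<Rightarrow> real \<Rightarrow> real" where
  "Green a b \<alpha> \<beta> \<psi> \<tau> t =
    (let C = 1 / (Gamma (\<alpha> + \<beta>) * (\<psi> b - \<psi> a) powr \<beta>);
         D = 1 / Gamma (\<alpha> + \<beta>)
     in if \<tau> \<le> t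
        then C * (\<psi> t - \<psi> a) powr \<beta> * (\<psi> b - \<psi> \<tau>) powr (\<alpha> + \<beta> - 1)
               - D * (\<psi> t - \<psi> \<tau>) powr (\<alpha> + \<beta> - 1)
        else C * (\<psi> t - \<psi> a) powr \<beta> * (\<psi> b - \<psi> \<tau>) powr (\<alpha> + \<beta> - 1))"

end

theory Submission
  imports Defs
begin

text \<open>
  With \<open>\<gamma> = \<alpha> + \<beta> - 1\<close>, the increment of \<open>G\<close> in \<open>t\<close> is \<open>1 / Gamma (\<alpha> + \<beta>)\<close> times the difference of the
  increments of two nondecreasing functions of \<open>t\<close>. Since \<open>x \<mapsto> x\<^sup>p\<close> is subadditive for \<open>0 < p \<le> 1\<close>
  and \<open>\<gamma> \<le> \<beta>\<close>, each of these increments lies between \<open>0\<close> and \<open>(\<psi> t2 - \<psi> t1)\<^sup>\<gamma>\<close>.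
\<close>

text \<open>Dividing by \<open>y\<close> reduces the claim to weights \<open>u\<close>,
  \<open>v\<close> in [0, 1] with sum 1. Such a weight satisfies \<open>w \<le> w powr p\<close>
  because \<open>p \<le> 1\<close>, so the two powers add up to at least 1; multiplying by
  \<open>y powr p\<close> restores the scale.\<close>

lemma powr_diff_le:
  fixes x y p :: real
  assumes "0 \<le> x" "x \<le> y" "0 \<le> p" "p \<le> 1"
  shows "y powr p - x powr p \<le> (y - x) powr p"
proof (cases "y = 0")
  case False
  with assms have y: "y > 0" by simp
  define u v where "u = x / y" and "v = (y - x) / y"
  have uv: "0 \<le> u" "u \<le> 1" "0 \<le> v" "v \<le> 1" and sum: "u + v = 1"
    using assms y by (auto simp: u_def v_def field_simps)
  have "u powr 1 \<le> u powr p" "v powr 1 \<le> v powr p"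
    using assms uv powr_mono'[of p 1 u] powr_mono'[of p 1 v] by simp_all
  with uv sum have "1 \<le> u powr p + v powr p" by simp
  hence "y powr p * 1 \<le> y powr p * (u powr p + v powr p)"
    by (intro mult_left_mono) auto
  also have "\<dots> = (y * u) powr p + (y * v) powr p"
    using uv y by (simp add: powr_mult distrib_left)
  also have "\<dots> = x powr p + (y - x) powr p"
    using y by (simp add: u_def v_def)
  finally show ?thesis by simp
qed (use assms in auto)

lemma has_real_derivative_pos_imp_strict_mono_on:
  fixes f f' :: "real \<Rightarrow> real"
  assumes deriv: "\<And>t. t \<in> {a..b} \<Longrightarrow> (f has_real_derivative f' t) (at t within {a..b})"
    and pos: "\<And>t. t \<in> {a..b} \<Longrightarrow> f' t > 0"
  shows "strict_mono_on {a..b} f"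
proof (rule strict_mono_onI)
  fix x y assume xy: "x \<in> {a..b}" "y \<in> {a..b}" "x < y"
  have "\<exists>t\<in>{x<..<y}. f y - f x = (\<lambda>h. f' t * h) (y - x)"
  proof (rule mvt_simple[OF \<open>x < y\<close>])
    fix t assume "x \<le> t" "t \<le> y"
    with deriv[of t] xy have "(f has_real_derivative f' t) (at t within {x..y})"
      by (auto intro: has_field_derivative_subset)
    thus "(f has_derivative (\<lambda>h. f' t * h)) (at t within {x..y})"
      by (simp add: has_field_derivative_def)
  qed
  then obtain t where t: "t \<in> {x<..<y}" "f y - f x = f' t * (y - x)" by auto
  with pos[of t] xy have "f' t * (y - x) > 0" by auto
  with t show "f x < f y" by simp
qed

text \<open>This controls the increment of the first term of the Green function: \<open>u\<close>,
  \<open>v\<close> stand for \<psi> at two times measured from \<psi>(a), \<open>L\<close> for the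
  total increase of \<psi>, and \<open>s\<close> for \<psi>(b) - \<psi>(\<tau>). The factor
  \<open>s powr \<gamma>\<close> is at most \<open>L powr \<gamma>\<close>, which restores the scale
  lost in the division by \<open>L powr \<beta>\<close>.\<close>

lemma scaled_powr_diff_bounds:
  fixes u v L s \<beta> \<gamma> :: real
  assumes "0 \<le> u" "u \<le> v" "v \<le> L" "0 < L" "0 \<le> s" "s \<le> L"
    and "0 \<le> \<gamma>" "\<gamma> \<le> \<beta>" "\<beta> \<le> 1"
  shows "0 \<le> (v powr \<beta> - u powr \<beta>) / L powr \<beta> * s powr \<gamma>"
    and "(v powr \<beta> - u powr \<beta>) / L powr \<beta> * s powr \<gamma> \<le> (v - u) powr \<gamma>"
proof -
  have mono: "u powr \<beta> \<le> v powr \<beta>"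
    using assms by (intro powr_mono2) auto
  thus "0 \<le> (v powr \<beta> - u powr \<beta>) / L powr \<beta> * s powr \<gamma>" by simp
  have "(v powr \<beta> - u powr \<beta>) / L powr \<beta> \<le> (v - u) powr \<beta> / L powr \<beta>"
    using assms by (intro divide_right_mono powr_diff_le) auto
  also have "\<dots> = ((v - u) / L) powr \<beta>"
    using assms by (simp add: powr_divide)
  \<comment> \<open>The base lies in [0, 1], so lowering the exponent from \<beta> to \<gamma>
    increases the power.\<close>
  also have "\<dots> \<le> ((v - u) / L) powr \<gamma>"
    using assms by (intro powr_mono') auto
  finally have "(v powr \<beta> - u powr \<beta>) / L powr \<beta> * s powr \<gamma>
      \<le> ((v - u) / L) powr \<gamma> * L powr \<gamma>"
    using assms by (intro mult_mono powr_mono2) auto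
  also have "\<dots> = (v - u) powr \<gamma>"
    using assms by (simp add: powr_divide)
  finally show "(v powr \<beta> - u powr \<beta>) / L powr \<beta> * s powr \<gamma> \<le> (v - u) powr \<gamma>" .
qed

theorem proposition3p4:
  fixes a b \<alpha> \<beta> :: real and \<psi> \<psi>' :: "real \<Rightarrow> real"
  assumes "a < b"
    and "0 < \<alpha>" and "\<alpha> \<le> 1"
    and "0 < \<beta>" and "\<beta> \<le> 1"
    and "\<alpha> + \<beta> > 1"
    and "\<forall>t\<in>{a..b}. (\<psi> has_real_derivative \<psi>' t) (at t within {a..b})"
    and "continuous_on {a..b} \<psi>'"
    and "\<forall>t\<in>{a..b}. \<psi>' t > 0"
  shows "\<forall>t1 t2 \<tau>. a \<le> t1 \<and> t1 \<le> t2 \<and> t2 \<le> b \<and> \<tau> \<in> {a..b} \<longrightarrow>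
    \<bar>Green a b \<alpha> \<beta> \<psi> \<tau> t2 - Green a b \<alpha> \<beta> \<psi> \<tau> t1\<bar>
      \<le> 2 / Gamma (\<alpha> + \<beta>) * (\<psi> t2 - \<psi> t1) powr (\<alpha> + \<beta> - 1)"
proof (intro allI impI)
  fix t1 t2 \<tau>
  assume "a \<le> t1 \<and> t1 \<le> t2 \<and> t2 \<le> b \<and> \<tau> \<in> {a..b}"
  hence t: "a \<le> t1" "t1 \<le> t2" "t2 \<le> b" "a \<le> \<tau>" "\<tau> \<le> b" by auto
  define \<gamma> where "\<gamma> = \<alpha> + \<beta> - 1"
  \<comment> \<open>The bound \<open>\<gamma> \<le> \<beta>\<close> is
    \<open>\<alpha> \<le> 1\<close> in disguise.\<close>
  have \<gamma>: "0 < \<gamma>" "\<gamma> \<le> \<beta>" "\<gamma> \<le> 1" using assms by (auto simp: \<gamma>_def)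
  have \<Gamma>: "Gamma (\<alpha> + \<beta>) > 0" using assms by (intro Gamma_real_pos) auto
  have sm: "strict_mono_on {a..b} \<psi>"
    using assms by (intro has_real_derivative_pos_imp_strict_mono_on[where f' = \<psi>']) auto
  have mono: "\<psi> x \<le> \<psi> y" if "a \<le> x" "x \<le> y" "y \<le> b" for x y
    using strict_mono_on_leD[OF sm, of x y] that by auto
  have L: "\<psi> b - \<psi> a > 0"
    using strict_mono_onD[OF sm, of a b] assms by auto
  define A where "A t = (\<psi> t - \<psi> a) powr \<beta> / (\<psi> b - \<psi> a) powr \<beta> * (\<psi> b - \<psi> \<tau>) powr \<gamma>" for t
  \<comment> \<open>Truncating at 0 merges the two clauses of \<open>Green\<close>: for
    \<open>t < \<tau>\<close> the base is 0, and \<open>0 powr \<gamma> = 0\<close>. This avoids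
    cases on the position of \<tau> relative to \<open>t1\<close> and \<open>t2\<close>.\<close>
  define B where "B t = max 0 (\<psi> t - \<psi> \<tau>) powr \<gamma>" for t
  have Green_eq: "Green a b \<alpha> \<beta> \<psi> \<tau> t = (A t - B t) / Gamma (\<alpha> + \<beta>)" if "a \<le> t" "t \<le> b" for t
  proof (cases "\<tau> \<le> t")
    case True
    with mono[of \<tau> t] that t have "max 0 (\<psi> t - \<psi> \<tau>) = \<psi> t - \<psi> \<tau>" by auto
    with True show ?thesis
      by (simp add: Green_def Let_def A_def B_def \<gamma>_def diff_divide_distrib mult.commute)
  next
    case False
    with mono[of t \<tau>] that t have "max 0 (\<psi> t - \<psi> \<tau>) = 0" by auto
    with False show ?thesis
      by (simp add: Green_def Let_def A_def B_def \<gamma>_def mult.commute)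
  qed
  define d where "d = (\<psi> t2 - \<psi> t1) powr \<gamma>"
  have A_diff: "A t2 - A t1 = ((\<psi> t2 - \<psi> a) powr \<beta> - (\<psi> t1 - \<psi> a) powr \<beta>)
      / (\<psi> b - \<psi> a) powr \<beta> * (\<psi> b - \<psi> \<tau>) powr \<gamma>"
    by (simp add: A_def diff_divide_distrib left_diff_distrib)
  have A: "0 \<le> A t2 - A t1" "A t2 - A t1 \<le> d"
    using scaled_powr_diff_bounds[of "\<psi> t1 - \<psi> a" "\<psi> t2 - \<psi> a" "\<psi> b - \<psi> a" "\<psi> b - \<psi> \<tau>" \<gamma> \<beta>]
      L \<gamma> assms(5) t mono[of a t1] mono[of t1 t2] mono[of t2 b] mono[of a \<tau>] mono[of \<tau> b]
    unfolding A_diff d_def by auto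
  define x y where "x = max 0 (\<psi> t1 - \<psi> \<tau>)" and "y = max 0 (\<psi> t2 - \<psi> \<tau>)"
  \<comment> \<open>The map \<open>max 0\<close> is nondecreasing and 1-Lipschitz, so truncation
    keeps the order and does not enlarge the increment of \<psi>.\<close>
  have xy: "0 \<le> x" "x \<le> y" "y - x \<le> \<psi> t2 - \<psi> t1"
    using mono[of t1 t2] t by (auto simp: x_def y_def)
  have B0: "0 \<le> B t2 - B t1"
    using xy \<gamma> powr_mono2[of \<gamma> x y] by (simp add: B_def x_def y_def)
  have "B t2 - B t1 = y powr \<gamma> - x powr \<gamma>"
    by (simp add: B_def x_def y_def)
  also have "\<dots> \<le> (y - x) powr \<gamma>"
    using xy \<gamma> by (intro powr_diff_le) auto
  also have "\<dots> \<le> d"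
    unfolding d_def using xy \<gamma> by (intro powr_mono2) auto
  finally have B1: "B t2 - B t1 \<le> d" .
  have "Green a b \<alpha> \<beta> \<psi> \<tau> t2 - Green a b \<alpha> \<beta> \<psi> \<tau> t1
      = ((A t2 - A t1) - (B t2 - B t1)) / Gamma (\<alpha> + \<beta>)"
    using Green_eq[of t1] Green_eq[of t2] t by (simp add: diff_divide_distrib)
  also have "\<bar>\<dots>\<bar> = \<bar>(A t2 - A t1) - (B t2 - B t1)\<bar> / Gamma (\<alpha> + \<beta>)"
    using \<Gamma> by simp
  \<comment> \<open>Both increments lie between 0 and \<open>d\<close>, so their difference is at
    most \<open>d\<close> in absolute value, and hence at most \<open>2 * d\<close>.\<close>
  also have "\<dots> \<le> 2 * d / Gamma (\<alpha> + \<beta>)"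
    using A B0 B1 \<Gamma> by (intro divide_right_mono) auto
  finally show "\<bar>Green a b \<alpha> \<beta> \<psi> \<tau> t2 - Green a b \<alpha> \<beta> \<psi> \<tau> t1\<bar>
      \<le> 2 / Gamma (\<alpha> + \<beta>) * (\<psi> t2 - \<psi> t1) powr (\<alpha> + \<beta> - 1)"
    by (simp add: d_def \<gamma>_def)
qed

end
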